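(* Let $a\ge b\ge0$ be integers. Then $$I_{a,b}=E_{a,b}\cdot\left\{\frac{\Delta_{\mathrm{Key}_l(\lambda)}(\mathbb X,\mathbb Y)}{\Delta(\mathbb X_1)\Delta(\mathbb X_2)}\ \Big|\ 0\le l\le b,\ \lambda\in P(l,b-l)\right\}.$$
   Context: Work over $\mathbb Q$. $\mathbb X_1=\{x_1,\dots,x_a\}$, $\mathbb X_2=\{x_{a+1},\dots,x_{a+b}\}$, $\mathbb X=\mathbb X_1\cup\mathbb X_2$, $\mathbb V=\{v_{L,1},\dots,v_{L,a},v_{R,1},\dots,v_{R,b}\}$ are commuting variables. $E_{a,b}=\mathbb Q[\mathbb X,\mathbb V]^{\mathfrak S_a\times\mathfrak S_b}=\mathrm{Sym}(\mathbb X_1|\mathbb X_2)[\mathbb V]$, where $\mathfrak S_a\times\mathfrak S_b$ permutes $\mathbb X_1$ and $\mathbb X_2$ and fixes $\mathbb V$. With $\mathbb Y=\{y_1,\dots,y_{a+b}\}$, the polynomial ring $\mathbb Q[\mathbb X,\mathbb Y]$ is embedded in $\mathbb Q[\mathbb X,\mathbb V]$ by $y_j\mapsto\sum_{k=1}^ax_j^{k-1}v_{L,k}$ for $1\le j\le a$ and $y_j\mapsto\sum_{k=1}^bx_j^{k-1}v_{R,k}$ for $a<j\le a+b$. $\Delta(\mathbb X_i)$ is the Vandermonde determinant of $\mathbb X_i$. $E\cdot S$ denotes the ideal of $E$ generated by $S$. $I_{a,b}=E_{a,b}\cdot\{f(\mathbb X,\mathbb Y)/(\Delta(\mathbb X_1)\Delta(\mathbb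 X_2))\mid f\in\mathbb Q[\mathbb X,\mathbb Y]\text{ antisymmetric under simultaneous permutation of the }x_j\text{ and }y_j\text{ by }\mathfrak S_{a+b}\}$ (each such quotient lies in $E_{a,b}$). $P(l,b-l)$ is the set of partitions $\lambda=(\lambda_1\ge\dots\ge\lambda_l\ge0)$ with at most $l$ parts and $\lambda_1\le b-l$. The key shape is the ordered list of $a+b$ monomials $\mathrm{Key}_l(\lambda)=\{x^{a+b-l-1},\dots,x,1\}\cup\{x^{\lambda_1+l-1}y,x^{\lambda_2+l-2}y,\dots,x^{\lambda_l}y\}$ in $\mathbb Q[x,y]$. For a list $S=(m_1,\dots,m_N)$ of monomials in $x,y$, $\Delta_S(\mathbb X,\mathbb Y)=\det(m_i(x_j,y_j))_{i,j=1}^N$ (here $N=a+b$). *)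

theory Defs
  imports
    "HOL-Library.Poly_Mapping"
    "HOL-Algebra.Ideal"
    "HOL-Combinatorics.Permutations"
    "Jordan_Normal_Form.Determinant"
begin

section \<open>Polynomials over the rationals\<close>

text \<open>
  All polynomial rings live inside one ambient ring of polynomials over \<open>\<rat>\<close>. Indices start at \<open>0\<close>:
  \<open>X j\<close>, \<open>Y j\<close>, \<open>VL k\<close>, \<open>VR k\<close> are the variables usually written
  $x_{j+1}$, $y_{j+1}$, $v_{L,k+1}$, $v_{R,k+1}$.
\<close>

datatype var = X nat | Y nat | VL nat | VR nat

type_synonym qpoly = "(var \<Rightarrow>\<^sub>0 nat) \<Rightarrow>\<^sub>0 rat"

definition Var :: "var \<Rightarrow> qpoly" where
  "Var v = Poly_Mapping.single (Poly_Mapping.single v 1) 1"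

definition Const :: "rat \<Rightarrow> qpoly" where
  "Const c = Poly_Mapping.single 0 c"

definition vars :: "qpoly \<Rightarrow> var set" where
  "vars p = (\<Union>m\<in>Poly_Mapping.keys p. Poly_Mapping.keys m)"

text \<open>The polynomial ring on a set of variables.\<close>

definition polys_on :: "var set \<Rightarrow> qpoly set" where
  "polys_on A = {p. vars p \<subseteq> A}"

definition monom_subst :: "(var \<Rightarrow> qpoly) \<Rightarrow> (var \<Rightarrow>\<^sub>0 nat) \<Rightarrow> qpoly" where
  "monom_subst s m = (\<Prod>v\<in>Poly_Mapping.keys m. s v ^ Poly_Mapping.lookup m v)"

text \<open>The \<open>\<rat>\<close>-algebra homomorphism sending each variable \<open>v\<close> to \<open>s v\<close>.\<close>

definition subst :: "(var \<Rightarrow> qpoly) \<Rightarrow> qpoly \<Rightarrow> qpoly" where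
  "subst s p = (\<Sum>m\<in>Poly_Mapping.keys p. Const (Poly_Mapping.lookup p m) * monom_subst s m)"


section \<open>Permutation actions and the ring \<open>E\<close>\<close>

definition act :: "(nat \<Rightarrow> nat) \<Rightarrow> qpoly \<Rightarrow> qpoly" where
  "act \<pi> = subst (\<lambda>v. case v of
      X j \<Rightarrow> Var (X (\<pi> j)) | Y j \<Rightarrow> Var (Y (\<pi> j)) | VL k \<Rightarrow> Var (VL k) | VR k \<Rightarrow> Var (VR k))"

definition XY_vars :: "nat \<Rightarrow> nat \<Rightarrow> var set" where
  "XY_vars a b = X ` {..<a + b} \<union> Y ` {..<a + b}"

definition XV_vars :: "nat \<Rightarrow> nat \<Rightarrow> var set" where
  "XV_vars a b = X ` {..<a + b} \<union> VL ` {..<a} \<union> VR ` {..<b}"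

definition Eab :: "nat \<Rightarrow> nat \<Rightarrow> qpoly set" where
  "Eab a b = {p \<in> polys_on (XV_vars a b).
      \<forall>\<sigma> \<tau>. \<sigma> permutes {..<a} \<longrightarrow> \<tau> permutes {a..<a + b} \<longrightarrow> act (\<sigma> \<circ> \<tau>) p = p}"

definition E_ring :: "nat \<Rightarrow> nat \<Rightarrow> qpoly ring" where
  "E_ring a b = \<lparr>carrier = Eab a b, monoid.mult = (*), one = 1, zero = 0, add = (+)\<rparr>"

text \<open>The embedding of $\mathbb{Q}[X,Y]$ into $\mathbb{Q}[X,V]$.\<close>

definition embed :: "nat \<Rightarrow> nat \<Rightarrow> qpoly \<Rightarrow> qpoly" where
  "embed a b = subst (\<lambda>v. case v of
      Y j \<Rightarrow> (if j < a then (\<Sum>k<a. Var (X j) ^ k * Var (VL k))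
                       else (\<Sum>k<b. Var (X j) ^ k * Var (VR k)))
    | _ \<Rightarrow> Var v)"

definition antisymmetric :: "nat \<Rightarrow> nat \<Rightarrow> qpoly set" where
  "antisymmetric a b = {f \<in> polys_on (XY_vars a b).
      \<forall>\<pi>. \<pi> permutes {..<a + b} \<longrightarrow> act \<pi> f = of_int (sign \<pi>) * f}"


section \<open>Determinants and generated ideals\<close>

text \<open>\<open>vandermonde m n\<close> is the Vandermonde determinant in the variables \<open>X m, \<dots>, X (m + n - 1)\<close>.
  The order of its rows affects only the sign, hence no ideal below.\<close>

definition vandermonde :: "nat \<Rightarrow> nat \<Rightarrow> qpoly" where
  "vandermonde m n = det (mat n n (\<lambda>(i, j). Var (X (m + j)) ^ i))"

text \<open>The pair \<open>(p, q)\<close> stands for the monomial $x^p y^q$.\<close>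

definition Delta :: "(nat \<times> nat) list \<Rightarrow> qpoly" where
  "Delta S = det (mat (length S) (length S)
      (\<lambda>(i, j). Var (X j) ^ fst (S ! i) * Var (Y j) ^ snd (S ! i)))"

text \<open>Partitions are padded with zeros to length exactly \<open>l\<close>.\<close>

definition Partitions :: "nat \<Rightarrow> nat \<Rightarrow> nat list set" where
  "Partitions l m = {lam. length lam = l \<and> sorted_wrt (\<ge>) lam \<and> (\<forall>x\<in>set lam. x \<le> m)}"

definition Key :: "nat \<Rightarrow> nat \<Rightarrow> nat \<Rightarrow> nat list \<Rightarrow> (nat \<times> nat) list" where
  "Key a b l lam = map (\<lambda>i. (i, 0)) (rev [0..<a + b - l])
                 @ map (\<lambda>i. (lam ! i + (l - 1 - i), 1)) [0..<l]"

text \<open>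
  The quotients $f / (\Delta(X_1)\Delta(X_2))$ with \<open>f \<in> F\<close>, as elements of \<open>Eab a b\<close>: since the ambient
  ring is a domain and the denominator is nonzero, at most one \<open>q\<close> belongs to each \<open>f\<close>.
\<close>

definition quotients :: "nat \<Rightarrow> nat \<Rightarrow> qpoly set \<Rightarrow> qpoly set" where
  "quotients a b F = {q \<in> Eab a b.
      \<exists>f\<in>F. q * (vandermonde 0 a * vandermonde a b) = embed a b f}"

definition Iab :: "nat \<Rightarrow> nat \<Rightarrow> qpoly set" where
  "Iab a b = genideal (E_ring a b) (quotients a b (antisymmetric a b))"


section \<open>The invariants form a commutative ring\<close>

text \<open>
  \<open>genideal R S\<close> is the intersection of the ideals of \<open>R\<close> containing \<open>S\<close>, so it is the generated ideal
  only if \<open>R\<close> is a ring and \<open>S\<close> is a subset of its carrier: see \<open>cring_E_ring\<close> and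
  \<open>quotients_subset\<close>.
\<close>

lemma monom_subst_superset:
  assumes "finite A" "Poly_Mapping.keys m \<subseteq> A"
  shows "monom_subst s m = (\<Prod>v\<in>A. s v ^ Poly_Mapping.lookup m v)"
  unfolding monom_subst_def using assms
  by (intro prod.mono_neutral_left) (auto simp: in_keys_iff)

lemma monom_subst_add: "monom_subst s (m + n) = monom_subst s m * monom_subst s n"
proof -
  let ?A = "Poly_Mapping.keys m \<union> Poly_Mapping.keys n"
  have "Poly_Mapping.keys (m + n) \<subseteq> ?A" by (rule Poly_Mapping.keys_add)
  then show ?thesis
    by (subst (1 2 3) monom_subst_superset[of ?A])
       (auto simp: lookup_add power_add prod.distrib)
qed

lemma Const_add: "Const (c + d) = Const c + Const d"
  by (simp add: Const_def single_add)

lemma Const_mult: "Const (c * d) = Const c * Const d"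
  by (simp add: Const_def mult_single)

lemma subst_superset:
  assumes "finite A" "Poly_Mapping.keys p \<subseteq> A"
  shows "subst s p = (\<Sum>m\<in>A. Const (Poly_Mapping.lookup p m) * monom_subst s m)"
  unfolding subst_def using assms
  by (intro sum.mono_neutral_left) (auto simp: in_keys_iff Const_def)

lemma subst_add: "subst s (p + q) = subst s p + subst s q"
proof -
  let ?A = "Poly_Mapping.keys p \<union> Poly_Mapping.keys q"
  have "Poly_Mapping.keys (p + q) \<subseteq> ?A" by (rule Poly_Mapping.keys_add)
  then show ?thesis
    by (subst (1 2 3) subst_superset[of ?A])
       (auto simp: lookup_add Const_add ring_distribs sum.distrib)
qed

lemma subst_zero: "subst s 0 = 0"
  by (simp add: subst_def)

lemma subst_single: "subst s (Poly_Mapping.single m c) = Const c * monom_subst s m"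
  by (cases "c = 0") (auto simp: subst_def Const_def)

lemma subst_sum: "subst s (sum f A) = (\<Sum>x\<in>A. subst s (f x))"
  by (induction A rule: infinite_finite_induct) (auto simp: subst_zero subst_add)

lemma qpoly_expand:
  "p = (\<Sum>m\<in>Poly_Mapping.keys p. Poly_Mapping.single m (Poly_Mapping.lookup p m))"
  by (rule poly_mapping_eqI)
     (auto simp: lookup_sum lookup_single when_def in_keys_iff)

lemma subst_mult: "subst s (p * q) = subst s p * subst s q"
proof -
  have "p * q = (\<Sum>m\<in>Poly_Mapping.keys p. \<Sum>n\<in>Poly_Mapping.keys q.
      Poly_Mapping.single (m + n) (Poly_Mapping.lookup p m * Poly_Mapping.lookup q n))"
    using arg_cong2[OF qpoly_expand[of p] qpoly_expand[of q], of "(*)"]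
    by (simp only: sum_product mult_single)
  then show ?thesis
    by (simp add: subst_sum subst_single Const_mult monom_subst_add)
       (simp add: subst_def sum_product ac_simps)
qed

lemma subst_one: "subst s 1 = 1"
proof -
  have "subst s (Poly_Mapping.single 0 1) = 1"
    by (simp only: subst_single) (simp add: Const_def monom_subst_def)
  then show ?thesis by simp
qed

lemma subst_uminus: "subst s (- p) = - subst s p"
  using subst_add[of s p "- p"] by (simp add: subst_zero add_eq_0_iff)

lemma polys_on_iff: "p \<in> polys_on A \<longleftrightarrow> (\<forall>m\<in>Poly_Mapping.keys p. Poly_Mapping.keys m \<subseteq> A)"
  unfolding polys_on_def vars_def by blast

lemma polys_on_add: "p \<in> polys_on A \<Longrightarrow> q \<in> polys_on A \<Longrightarrow> p + q \<in> polys_on A"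
  unfolding polys_on_iff using Poly_Mapping.keys_add[of p q] by blast

lemma polys_on_uminus: "p \<in> polys_on A \<Longrightarrow> - p \<in> polys_on A"
  by (simp add: polys_on_iff)

lemma polys_on_mult:
  assumes "p \<in> polys_on A" "q \<in> polys_on A"
  shows "p * q \<in> polys_on A"
  unfolding polys_on_iff
proof
  fix k assume "k \<in> Poly_Mapping.keys (p * q)"
  then have "k \<in> {m + n | m n. m \<in> Poly_Mapping.keys p \<and> n \<in> Poly_Mapping.keys q}"
    by (rule subsetD[OF keys_mult])
  then obtain m n where "m \<in> Poly_Mapping.keys p" "n \<in> Poly_Mapping.keys q" "k = m + n"
    by blast
  with assms show "Poly_Mapping.keys k \<subseteq> A"
    unfolding polys_on_iff using Poly_Mapping.keys_add[of m n] by blast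
qed

lemma Eab_closed:
  "p \<in> Eab a b \<Longrightarrow> q \<in> Eab a b \<Longrightarrow> p + q \<in> Eab a b"
  "p \<in> Eab a b \<Longrightarrow> q \<in> Eab a b \<Longrightarrow> p * q \<in> Eab a b"
  "p \<in> Eab a b \<Longrightarrow> - p \<in> Eab a b"
  by (simp_all add: Eab_def act_def subst_add subst_mult subst_uminus
        polys_on_add polys_on_mult polys_on_uminus)

lemma Eab_zero_one: "0 \<in> Eab a b" "1 \<in> Eab a b"
  by (simp_all add: Eab_def act_def subst_zero subst_one)
     (simp_all add: polys_on_iff)

lemma cring_E_ring: "cring (E_ring a b)"
proof (rule cringI)
  show "abelian_group (E_ring a b)"
  proof (rule abelian_groupI)
    fix p assume "p \<in> carrier (E_ring a b)"
    then show "\<exists>q\<in>carrier (E_ring a b). q \<oplus>\<^bsub>E_ring a b\<^esub> p = \<zero>\<^bsub>E_ring a b\<^esub>"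
      by (intro bexI[of _ "- p"]) (simp_all add: E_ring_def Eab_closed)
  qed (simp_all add: E_ring_def Eab_closed Eab_zero_one add.assoc add.commute)
  show "Group.comm_monoid (E_ring a b)"
    by (rule comm_monoidI)
       (simp_all add: E_ring_def Eab_closed Eab_zero_one mult.assoc mult.commute)
qed (simp_all add: E_ring_def distrib_right)

lemma quotients_subset: "quotients a b F \<subseteq> carrier (E_ring a b)"
  by (auto simp: quotients_def E_ring_def)

end

theory Submission
  imports Defs
begin

text \<open>
  Write $n = a + b$ and $D(S)$ for the image of $\Delta_S(X, Y)$ under the embedding into
  $\mathbb{Q}[X, V]$, so that $D(S) = \det(x_j^p y_j^q)$ with a row for each $(p, q)$ in $S$ and with
  $y_j = p_L(x_j)$ in the first block of variables and $y_j = p_R(x_j)$ in the second one, where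
  $p_L$ and $p_R$ are the generic polynomials with the $v_{L,k}$ and $v_{R,k}$ as coefficients.
  Antisymmetrising monomials shows that every antisymmetric polynomial is a rational linear
  combination of determinants $\Delta_S$. Hence it suffices to write each $D(S)$ as a combination of
  the determinants of key shapes with coefficients in $E$ (\<open>D_in_span\<close>). Determinants are
  linear in each row, and three sources of relations with coefficients in $E$ are enough.

  \<^item> At every point $(y - p_L(x)) (y - p_R(x)) = 0$. This replaces a row $x^p y^{q+2}$ by rows
    of smaller degree in $y$, so the degree in $y$ may be taken at most $1$ (\<open>D_reduce_degree\<close>).
  \<^item> The polynomial $f_R(x) = \prod_{j > a} (x - x_j)$ vanishes on the second block, and
    $y = p_L(x)$ holds on the first, so $f_R(x) y = f_R(x) p_L(x)$ everywhere. As $f_R$ is monic of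
    degree $b$, this replaces a row $x^p y$ with $p \ge b$ by rows $x^{p'} y$ with $p' < p$ and by
    rows free of $y$ (\<open>D_blocks_reduce\<close>).
  \<^item> An elementary symmetric polynomial $e_r$ of all the $x_j$ lies in $E$, and
    $e_r D(S) = \sum_R D(S^R)$, where $R$ ranges over the sets of $r$ rows and $S^R$ arises from $S$
    by multiplying the rows in $R$ by $x$. When $l$ rows contain $y$, this allows the remaining
    $m = n - l$ rows to be pushed down to $1, x, \dots, x^{m-1}$ (\<open>D_blocks\<close>). In terms of
    symmetric functions, this is the fact that $\mathrm{Sym}(t | s)$ is generated as a module over
    $\mathrm{Sym}(t, s)$ by $\mathrm{Sym}(s)$.

  What remains are the rows $1, \dots, x^{m-1}$ and $l$ rows $x^p y$ with distinct exponents
  $p < b$. Subtracting the staircase $l - 1, \dots, 0$ from the decreasing list of these exponents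
  yields the partitions in $P(l, b - l)$, that is, the key shapes.

  Dividing by $V = \Delta(X_1) \Delta(X_2)$ is harmless. Reducing $x^p y^q$ modulo
  $\prod_{j \le a} (x - x_j)$ on the first block and modulo $f_R$ on the second one factors the matrix
  of $D(S)$ into a matrix over $E$ and a block diagonal matrix with determinant $V$, so the quotient
  exists in $E$ (\<open>Delta_quotient\<close>). It is unique since $V \neq 0$ and the ambient ring is a domain.
\<close>

section \<open>Determinants and elementary symmetric polynomials\<close>

lemma det_linear_row:
  fixes c :: "'k \<Rightarrow> 'r::comm_ring_1"
  assumes "i < n"
  shows "det (mat n n (\<lambda>(i', j). if i' = i then (\<Sum>k\<in>K. c k * u k j) else M i' j)) =
    (\<Sum>k\<in>K. c k * det (mat n n (\<lambda>(i', j). if i' = i then u k j else M i' j)))"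
proof -
  have expand: "det (mat n n (\<lambda>(i', j). if i' = i then v j else M i' j)) =
      (\<Sum>p | p permutes {0..<n}. v (p i) * (signof p * (\<Prod>i'\<in>{0..<n} - {i}. M i' (p i'))))"
    for v :: "nat \<Rightarrow> 'r"
  proof -
    have "(\<Prod>i' = 0..<n. mat n n (\<lambda>(i', j). if i' = i then v j else M i' j) $$ (i', p i')) =
        v (p i) * (\<Prod>i'\<in>{0..<n} - {i}. M i' (p i'))" if "p permutes {0..<n}" for p
    proof -
      have lt: "p i' < n" if "i' < n" for i'
        using permutes_in_image[OF \<open>p permutes {0..<n}\<close>, of i'] that by simp
      show ?thesis
        using assms by (subst prod.remove[of _ i]) (auto simp: lt intro!: prod.cong)
    qed
    then show ?thesis
      by (subst det_def'[of _ n]) (auto intro!: sum.cong simp: mult_ac)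
  qed
  show ?thesis
    unfolding expand sum_distrib_left sum_distrib_right
    by (subst sum.swap) (simp add: mult_ac)
qed

lemma esym_invariant:
  fixes x :: "nat \<Rightarrow> 'r::comm_ring_1"
  assumes p: "p permutes {0..<n}"
  shows "(\<Sum>R | R \<subseteq> {0..<n} \<and> card R = r. \<Prod>i\<in>R. x (p i)) =
    (\<Sum>R | R \<subseteq> {0..<n} \<and> card R = r. \<Prod>j\<in>R. x j)"
    (is "(\<Sum>R\<in>?\<R>. _ R) = ?e")
proof -
  let ?q = "inv_into UNIV p"
  have q: "?q permutes {0..<n}" using p by (rule permutes_inv)
  have image: "s ` R \<in> ?\<R>" if s: "s permutes {0..<n}" and R: "R \<in> ?\<R>" for s R
  proof -
    have "s ` R \<subseteq> s ` {0..<n}" using R by blast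
    moreover have "card (s ` R) = card R"
      by (rule card_image) (rule inj_on_subset[OF permutes_inj[OF s]], simp)
    ultimately show ?thesis using R permutes_image[OF s] by simp
  qed
  have "bij_betw ((`) p) ?\<R> ?\<R>"
  proof (rule bij_betw_byWitness[where f' = "(`) ?q"])
    show "\<forall>R\<in>?\<R>. ?q ` p ` R = R" "\<forall>R\<in>?\<R>. p ` ?q ` R = R"
      using permutes_inv_o[OF p] by (simp_all only: image_comp image_id id_apply) simp_all
    show "(`) p ` ?\<R> \<subseteq> ?\<R>" "(`) ?q ` ?\<R> \<subseteq> ?\<R>"
      using image[OF p] image[OF q] by blast+
  qed
  then have "(\<Sum>R\<in>?\<R>. \<Prod>j\<in>p ` R. x j) = ?e" by (rule sum.reindex_bij_betw)
  moreover have "(\<Prod>j\<in>p ` R. x j) = (\<Prod>i\<in>R. x (p i))" for R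
    by (simp add: prod.reindex[OF inj_on_subset[OF permutes_inj[OF p]]])
  ultimately show ?thesis by simp
qed

text \<open>
  In the Leibniz expansion a permutation \<open>p\<close> contributes, up to sign,
  $\prod_i M_{i, p(i)} \cdot \sum_R \prod_{i \in R} x_{p(i)}$ to the right-hand side, and the inner sum is
  $e_r(x)$ because $p$ permutes the $r$-subsets.
\<close>

lemma det_raise_rows:
  fixes x :: "nat \<Rightarrow> 'r::comm_ring_1"
  shows "(\<Sum>R | R \<subseteq> {0..<n} \<and> card R = r. \<Prod>j\<in>R. x j) * det (mat n n (\<lambda>(i, j). M i j)) =
    (\<Sum>R | R \<subseteq> {0..<n} \<and> card R = r.
      det (mat n n (\<lambda>(i, j). (if i \<in> R then x j else 1) * M i j)))"
    (is "?e * _ = (\<Sum>R\<in>?\<R>. _)")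
proof -
  have lt: "p i < n" if "p permutes {0..<n}" "i < n" for p i
    using permutes_in_image[OF that(1), of i] that by simp
  have rows: "det (mat n n (\<lambda>(i, j). (if i \<in> R then x j else 1) * M i j)) =
      (\<Sum>p | p permutes {0..<n}. signof p * (\<Prod>i = 0..<n. M i (p i)) * (\<Prod>i\<in>R. x (p i)))"
    if "R \<subseteq> {0..<n}" for R
  proof -
    have "(\<Prod>i = 0..<n. (if i \<in> R then x (p i) else 1) * M i (p i)) =
        (\<Prod>i = 0..<n. M i (p i)) * (\<Prod>i\<in>R. x (p i))" for p
      using that by (simp add: prod.distrib prod.If_cases Int_absorb1 mult.commute)
    then show ?thesis
      by (subst det_def'[of _ n]) (auto intro!: sum.cong simp: lt mult.assoc)
  qed
  have "det (mat n n (\<lambda>(i, j). M i j)) =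
      (\<Sum>p | p permutes {0..<n}. signof p * (\<Prod>i = 0..<n. M i (p i)))"
    by (subst det_def'[of _ n]) (auto intro!: sum.cong simp: lt)
  then have "?e * det (mat n n (\<lambda>(i, j). M i j)) =
      (\<Sum>p | p permutes {0..<n}. signof p * (\<Prod>i = 0..<n. M i (p i)) * (\<Sum>R\<in>?\<R>. \<Prod>i\<in>R. x (p i)))"
    by (simp add: esym_invariant sum_distrib_left sum_distrib_right mult_ac)
  also have "\<dots> = (\<Sum>R\<in>?\<R>. det (mat n n (\<lambda>(i, j). (if i \<in> R then x j else 1) * M i j)))"
    unfolding sum_distrib_left by (subst sum.swap) (intro sum.cong refl, simp add: rows)
  finally show ?thesis .
qed

section \<open>Spanning by determinants of key shapes\<close>

definition blocks :: "nat list \<Rightarrow> nat list \<Rightarrow> (nat \<times> nat) list" where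
  "blocks I J = map (\<lambda>i. (i, 0)) I @ map (\<lambda>j. (j, 1)) J"

lemma strictly_decreasing_gap:
  fixes xs :: "nat list"
  assumes "sorted_wrt (>) xs" "i \<le> j" "j < length xs"
  shows "xs ! j + (j - i) \<le> xs ! i"
  using assms(2,3)
proof (induction j rule: dec_induct)
  case (step j)
  have "xs ! Suc j < xs ! j" using sorted_wrt_nth_less[OF assms(1), of j "Suc j"] step by simp
  with step show ?case by simp
qed simp

text \<open>
  A strictly decreasing list of $l$ numbers below $b$ lies above the staircase $l - 1, \dots, 0$, and
  the difference is a partition inside the $l \times (b - l)$ box.
\<close>

lemma strictly_decreasing_staircase:
  assumes desc: "sorted_wrt (>) xs" and len: "length xs = l" and bound: "\<forall>x\<in>set xs. x < b"
  obtains lam where "l \<le> b" "lam \<in> Partitions l (b - l)"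
    "xs = map (\<lambda>i. lam ! i + (l - 1 - i)) [0..<l]"
proof
  let ?lam = "map (\<lambda>i. xs ! i - (l - 1 - i)) [0..<l]"
  have ge: "l - 1 - i \<le> xs ! i" and le: "xs ! i + i < b" if "i < l" for i
  proof -
    have "xs ! (l - 1) + (l - 1 - i) \<le> xs ! i"
      by (rule strictly_decreasing_gap[OF desc]) (use that len in auto)
    then show "l - 1 - i \<le> xs ! i" by linarith
    have "0 < length xs" using that len by simp
    then have "xs ! 0 < b" using bound nth_mem by blast
    then show "xs ! i + i < b"
      using strictly_decreasing_gap[OF desc, of 0 i] that len by simp
  qed
  show "l \<le> b" using ge[of 0] le[of 0] by (cases "l = 0") auto
  show "xs = map (\<lambda>i. ?lam ! i + (l - 1 - i)) [0..<l]"
  proof (rule nth_equalityI)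
    show "xs ! i = map (\<lambda>i. ?lam ! i + (l - 1 - i)) [0..<l] ! i" if "i < length xs" for i
      using that len le_add_diff_inverse2[OF ge[of i]] by (simp del: diff_diff_left)
  qed (simp add: len)
  have "sorted_wrt (\<ge>) ?lam"
    unfolding sorted_wrt_iff_nth_less
  proof (intro allI impI)
    fix i j assume "i < j" "j < length ?lam"
    then show "?lam ! j \<le> ?lam ! i"
      using strictly_decreasing_gap[OF desc, of i j] len by simp
  qed
  then show "?lam \<in> Partitions l (b - l)"
    using le by (force simp: Partitions_def)
qed

text \<open>
  The setting keeps only what the reduction uses: \<open>E\<close> is a set of coefficients, \<open>Q\<close> is closed under
  the operations of an \<open>E\<close>-module, and \<open>y\<close> obeys one quadratic and one linear relation over
  \<open>E[x]\<close> at all points. In the application \<open>A\<close> and \<open>-B\<close> are the sum and the product of the two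
  polynomials that \<open>y\<close> equals on the two blocks, and \<open>F\<close> vanishes on the second block.
\<close>

locale bialternant_span =
  fixes n b :: nat and x y :: "nat \<Rightarrow> 'r::comm_ring_1" and E Q :: "'r set"
    and A B F G :: "'r poly"
  assumes Q_zero: "0 \<in> Q"
    and Q_add: "p \<in> Q \<Longrightarrow> q \<in> Q \<Longrightarrow> p + q \<in> Q"
    and Q_uminus: "p \<in> Q \<Longrightarrow> - p \<in> Q"
    and Q_mult: "c \<in> E \<Longrightarrow> q \<in> Q \<Longrightarrow> c * q \<in> Q"
    and esym: "(\<Sum>R | R \<subseteq> {0..<n} \<and> card R = r. \<Prod>j\<in>R. x j) \<in> E"
    and coeffs: "coeff A k \<in> E" "coeff B k \<in> E" "- coeff F k \<in> E" "coeff G k \<in> E"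
    and quadratic: "j < n \<Longrightarrow> y j ^ 2 = poly A (x j) * y j + poly B (x j)"
    and monic: "degree F = b" "lead_coeff F = 1"
    and linear: "j < n \<Longrightarrow> poly F (x j) * y j = poly G (x j)"
begin

definition D :: "(nat \<times> nat) list \<Rightarrow> 'r" where
  "D S = det (mat n n (\<lambda>(i, j). x j ^ fst (S ! i) * y j ^ snd (S ! i)))"

lemma Q_sum: "(\<And>k. k \<in> K \<Longrightarrow> f k \<in> Q) \<Longrightarrow> sum f K \<in> Q"
  by (induction K rule: infinite_finite_induct) (auto intro: Q_zero Q_add)

lemma D_replace_row:
  assumes "length S = n" "i < n"
    and c: "\<And>k. k \<in> K \<Longrightarrow> c k \<in> E"
    and row: "\<And>j. j < n \<Longrightarrow> x j ^ fst (S ! i) * y j ^ snd (S ! i) =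
      (\<Sum>k\<in>K. c k * (x j ^ fst (w k) * y j ^ snd (w k)))"
    and Q: "\<And>k. k \<in> K \<Longrightarrow> D (S[i := w k]) \<in> Q"
  shows "D S \<in> Q"
proof -
  let ?M = "\<lambda>i j. x j ^ fst (S ! i) * y j ^ snd (S ! i)"
  have "D S = det (mat n n (\<lambda>(i', j). if i' = i
      then (\<Sum>k\<in>K. c k * (x j ^ fst (w k) * y j ^ snd (w k))) else ?M i' j))"
    unfolding D_def by (intro arg_cong[of _ _ det] cong_mat refl) (auto simp: row)
  also have "\<dots> = (\<Sum>k\<in>K. c k * D (S[i := w k]))"
    unfolding det_linear_row[OF \<open>i < n\<close>] D_def using assms(1,2)
    by (intro sum.cong refl arg_cong2[of _ _ _ _ "(*)"] arg_cong[of _ _ det] cong_mat)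
       (auto simp: nth_list_update)
  also have "\<dots> \<in> Q" using c Q by (intro Q_sum Q_mult) auto
  finally show ?thesis .
qed

lemma D_not_distinct:
  assumes "length S = n" "\<not> distinct S"
  shows "D S = 0"
proof -
  obtain i j where "i < n" "j < n" "i \<noteq> j" "S ! i = S ! j"
    using assms by (auto simp: distinct_conv_nth)
  then show ?thesis unfolding D_def
    by (intro det_identical_rows[of _ n i j]) (auto intro!: eq_vecI)
qed

lemma D_cong_mset:
  assumes "mset S = mset S'" "length S' = n" "D S' \<in> Q"
  shows "D S \<in> Q"
proof -
  obtain p where p: "p permutes {..<n}" and S: "permute_list p S' = S"
    using mset_eq_permutation[OF assms(1)] assms(2) by blast
  have p': "p permutes {0..<n}" using p by (simp add: atLeast0LessThan)
  have lt: "p i < n" if "i < n" for i using permutes_in_image[OF p, of i] that by simp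
  have "D S = det (mat n n (\<lambda>(i, j). mat n n (\<lambda>(i, j). x j ^ fst (S' ! i) * y j ^ snd (S' ! i)) $$ (p i, j)))"
    unfolding D_def by (intro arg_cong[of _ _ det] cong_mat refl)
      (use p assms(2) in \<open>auto simp: lt S[symmetric] permute_list_nth\<close>)
  also have "\<dots> = signof p * D S'" unfolding D_def by (rule det_permute_rows[OF _ p']) simp
  also have "\<dots> \<in> Q" using assms(3) by (auto simp: sign_def Q_uminus)
  finally show ?thesis .
qed

lemma esym_D:
  "(\<Sum>R | R \<subseteq> {0..<n} \<and> card R = r. \<Prod>j\<in>R. x j) * D S =
    (\<Sum>R | R \<subseteq> {0..<n} \<and> card R = r.
      D (map (\<lambda>i. (fst (S ! i) + (if i \<in> R then 1 else 0), snd (S ! i))) [0..<n]))"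
  unfolding D_def det_raise_rows
  by (intro sum.cong refl arg_cong[of _ _ det] cong_mat) auto

lemma blocks_raise:
  assumes "length I = m" "length J = l" "m + l = n"
  shows "map (\<lambda>i. (fst (blocks I J ! i) + (if i \<in> R then 1 else 0), snd (blocks I J ! i))) [0..<n] =
    blocks (map (\<lambda>i. I ! i + (if i \<in> R then 1 else 0)) [0..<m])
           (map (\<lambda>i. J ! i + (if m + i \<in> R then 1 else 0)) [0..<l])"
  using assms by (intro nth_equalityI) (auto simp: blocks_def nth_append)

lemma sum_list_raise:
  assumes "length I = m"
  shows "sum_list (map (\<lambda>i. I ! i + (if i \<in> R then 1 else 0)) [0..<m]) =
    sum_list I + card (R \<inter> {0..<m})"
  using assms
  by (simp add: sum_list_sum_nth sum.distrib sum.If_cases Int_commute)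

text \<open>
  Let \<open>g\<close> be the least number missing from \<open>I\<close>, and let \<open>I'\<close> arise from \<open>I\<close> by lowering the \<open>r\<close> entries
  above \<open>g\<close> by one. In the expansion of $e_r D(I', J)$ the set of exactly these rows gives back
  $D(I, J)$. Every other set of \<open>r\<close> rows raises some row of \<open>J\<close>, and then the sum of the entries of
  \<open>I\<close> drops, or it raises an entry below \<open>g\<close>, and then the least missing number drops. Hence the pair
  of these two numbers decreases lexicographically. The induction stops only if nothing lies above
  \<open>g\<close>, which for distinct entries means that \<open>I\<close> is $\{0, \dots, m - 1\}$.
\<close>

lemma D_blocks:
  assumes ml: "m + l = n"
    and base: "\<And>J. length J = l \<Longrightarrow> D (blocks [0..<m] J) \<in> Q"
    and "length I = m" "length J = l"
  shows "D (blocks I J) \<in> Q"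
  using assms(3,4)
proof (induction "(sum_list I, LEAST k. k \<notin> set I)" arbitrary: I J
    rule: wf_induct_rule[OF wf_lex_prod[OF wf_less_than wf_less_than]])
  case (1 I J)
  have IH: "D (blocks I' J') \<in> Q"
    if "length I' = m" "length J' = l"
      "sum_list I' < sum_list I \<or> sum_list I' = sum_list I \<and> k \<notin> set I' \<and> k < (LEAST k. k \<notin> set I)"
    for I' J' k
  proof -
    have "(LEAST k. k \<notin> set I') < (LEAST k. k \<notin> set I)" if "k \<notin> set I'" "k < (LEAST k. k \<notin> set I)"
      using Least_le[of "\<lambda>k. k \<notin> set I'", OF that(1)] that(2) by linarith
    with that show ?thesis by (intro 1(1)) auto
  qed
  define g where "g = (LEAST k. k \<notin> set I)"
  have "\<exists>k. k \<notin> set I" using ex_new_if_finite[of "set I"] by auto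
  then have g: "g \<notin> set I" unfolding g_def by (rule LeastI_ex)
  have below: "k \<in> set I" if "k < g" for k
    using that not_less_Least unfolding g_def by blast
  show ?case
  proof (cases "distinct I")
    case False
    then have "\<not> distinct (blocks I J)" by (auto simp: blocks_def distinct_map)
    then show ?thesis using D_not_distinct[of "blocks I J"] 1(2,3) ml Q_zero
      by (simp add: blocks_def)
  next
    case dist: True
    define R0 where "R0 = {i. i < m \<and> g < I ! i}"
    show ?thesis
    proof (cases "R0 = {}")
      case True
      have "set I \<subseteq> {..<g}"
      proof
        fix v assume "v \<in> set I"
        then obtain i where "i < m" "v = I ! i" using 1(2) by (metis in_set_conv_nth)
        moreover have "v \<noteq> g" using g \<open>v \<in> set I\<close> by blast
        ultimately show "v \<in> {..<g}" using True unfolding R0_def by force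
      qed
      then have set_I: "set I = {..<g}" using below by auto
      have "g = m" using distinct_card[OF dist] 1(2) by (simp add: set_I)
      then have "mset I = mset [0..<m]"
        using set_eq_iff_mset_eq_distinct[OF dist, of "[0..<m]"] set_I
        by (simp add: atLeast0LessThan del: mset_upt)
      then have "mset (blocks I J) = mset (blocks [0..<m] J)"
        by (simp add: blocks_def)
      then show ?thesis
        by (rule D_cong_mset[OF _ _ base]) (use 1(3) ml in \<open>auto simp: blocks_def\<close>)
    next
      case False
      define r where "r = card R0"
      define I' where "I' = map (\<lambda>v. if g < v then v - 1 else v) I"
      have len': "length I' = m" using 1(2) by (simp add: I'_def)
      have R0: "finite R0" "R0 \<subseteq> {0..<m}" by (auto simp: R0_def)
      have r: "r > 0" using False R0 by (auto simp: r_def card_gt_0_iff)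
      have I: "I = map (\<lambda>i. I' ! i + (if i \<in> R0 then 1 else 0)) [0..<m]"
        using 1(2) by (intro nth_equalityI) (auto simp: I'_def R0_def)
      have sumI: "sum_list I = sum_list I' + r"
        using sum_list_raise[OF len', of R0] R0 I by (simp add: r_def Int_absorb2)
      have I'_nth: "I' ! i = (if g < I ! i then I ! i - 1 else I ! i)" if "i < m" for i
        using that 1(2) by (simp add: I'_def)
      have I_ne: "I ! i \<noteq> g" if "i < m" for i using that g 1(2) nth_mem by blast
      have inj': "i = j" if "I' ! i = I' ! j" "i < m" "j < m" for i j
      proof -
        have "I ! i = I ! j" using that I'_nth[of i] I'_nth[of j] I_ne[of i] I_ne[of j]
          by (auto split: if_splits)
        then show ?thesis using dist that 1(2) by (simp add: nth_eq_iff_index_eq)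
      qed
      let ?\<R> = "{R. R \<subseteq> {0..<n} \<and> card R = r}"
      let ?S = "\<lambda>R. map (\<lambda>i. (fst (blocks I' J ! i) + (if i \<in> R then 1 else 0), snd (blocks I' J ! i))) [0..<n]"
      have others: "D (?S R) \<in> Q" if R: "R \<in> ?\<R> - {R0}" for R
      proof -
        let ?I = "map (\<lambda>i. I' ! i + (if i \<in> R then 1 else 0)) [0..<m]"
        let ?J = "map (\<lambda>i. J ! i + (if m + i \<in> R then 1 else 0)) [0..<l]"
        have fR: "finite R" using R finite_subset[of R "{0..<n}"] by auto
        have S: "?S R = blocks ?I ?J" using blocks_raise[OF len' 1(3) ml] .
        have sum: "sum_list ?I = sum_list I' + card (R \<inter> {0..<m})"
          using sum_list_raise[OF len'] .
        show ?thesis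
        proof (cases "R \<subseteq> {0..<m}")
          case False
          then have "R \<inter> {0..<m} \<subset> R" by blast
          then have "card (R \<inter> {0..<m}) < r" using R fR psubset_card_mono[of R] by auto
          then show ?thesis unfolding S using sum sumI by (intro IH) auto
        next
          case Rm: True
          have "\<not> R \<subseteq> R0" using R R0 card_subset_eq[of R0 R] by (auto simp: r_def)
          then obtain i0 where i0: "i0 \<in> R" "i0 \<notin> R0" by blast
          \<comment> \<open>The smallest value that is raised leaves a hole: the value below it stays put.\<close>
          define e where "e = Min ((!) I' ` R)"
          have "e \<in> (!) I' ` R" unfolding e_def using i0 fR by (intro Min_in) auto
          then obtain i where i: "i \<in> R" "e = I' ! i" by blast
          have "e \<le> I' ! i0" unfolding e_def using i0 fR by (intro Min_le) auto
          moreover have "I' ! i0 < g"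
            using i0 Rm I'_nth[of i0] I_ne[of i0] by (force simp: R0_def)
          ultimately have "e < g" by linarith
          moreover have "e \<notin> set ?I"
          proof
            assume "e \<in> set ?I"
            then obtain k where k: "k < m" "e = I' ! k + (if k \<in> R then 1 else 0)" by auto
            show False
            proof (cases "k \<in> R")
              case True
              then have "e \<le> I' ! k" unfolding e_def using fR by (intro Min_le) auto
              with k True show False by simp
            next
              case False
              then have "I' ! k = I' ! i" using k i by simp
              then have "k = i" using inj' k i Rm by auto
              with False i show False by simp
            qed
          qed
          moreover have "sum_list ?I = sum_list I"
            using sum sumI Rm R by (auto simp: Int_absorb2)
          ultimately show ?thesis unfolding S by (intro IH[of _ _ e]) (auto simp: g_def)
        qed
      qed
      have fin: "finite ?\<R>" by (rule finite_subset[of _ "Pow {0..<n}"]) auto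
      have "R0 \<in> ?\<R>" using R0 ml by (auto simp: r_def)
      moreover have "?S R0 = blocks I J"
      proof -
        have "map (\<lambda>i. J ! i + (if m + i \<in> R0 then 1 else 0)) [0..<l] = J"
          using 1(3) by (intro nth_equalityI) (auto simp: R0_def)
        then show ?thesis using blocks_raise[OF len' 1(3) ml, of R0] I by simp
      qed
      ultimately have "D (blocks I J) =
          (\<Sum>R | R \<subseteq> {0..<n} \<and> card R = r. \<Prod>j\<in>R. x j) * D (blocks I' J) +
          - (\<Sum>R\<in>?\<R> - {R0}. D (?S R))"
        using esym_D[of r "blocks I' J"] sum.remove[OF fin, of R0 "\<lambda>R. D (?S R)"] by simp
      also have "\<dots> \<in> Q"
        using len' 1(3) sumI r others
        by (intro Q_add Q_mult Q_uminus Q_sum esym IH) auto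
      finally show ?thesis .
    qed
  qed
qed

text \<open>
  Multiplying \<open>linear\<close> by \<open>x ^ p\<close> and using that \<open>F\<close> is monic rewrites a row \<open>x ^ (p + b) * y\<close>: the
  terms that keep \<open>y\<close> have a smaller exponent, and the others fall under the assumption \<open>lower\<close>,
  which is the induction hypothesis on the degree in \<open>y\<close>.
\<close>

lemma D_blocks_reduce:
  assumes ml: "m + l = n"
    and lower: "\<And>S. length S = n \<Longrightarrow> sum_list (map snd S) < l \<Longrightarrow> D S \<in> Q"
    and key: "\<And>J. length J = l \<Longrightarrow> distinct J \<Longrightarrow> \<forall>j\<in>set J. j < b \<Longrightarrow> D (blocks [0..<m] J) \<in> Q"
    and "length J = l"
  shows "D (blocks [0..<m] J) \<in> Q"
  using assms(4)
proof (induction "sum_list J" arbitrary: J rule: less_induct)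
  case less
  let ?S = "blocks [0..<m] J"
  have len: "length ?S = n" using less.prems ml by (simp add: blocks_def)
  consider (repeat) "\<not> distinct J" | (key) "distinct J" "\<forall>j\<in>set J. j < b" | (big) "\<exists>j\<in>set J. b \<le> j"
    by force
  then show ?case
  proof cases
    case repeat
    then have "\<not> distinct ?S" by (auto simp: blocks_def distinct_map)
    then show ?thesis using D_not_distinct len Q_zero by simp
  next
    case key
    then show ?thesis using assms(3) less.prems by simp
  next
    case big
    then obtain i where i: "i < l" "b \<le> J ! i" using less.prems by (metis in_set_conv_nth)
    define p where "p = J ! i - b"
    define w where "w = case_sum (\<lambda>k. (p + k, 1)) (\<lambda>k. (p + k, 0 :: nat))"
    show ?thesis
    proof (rule D_replace_row[OF len, of "m + i"])
      show "m + i < n" using i ml by simp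
      have Smi: "?S ! (m + i) = (p + b, 1)"
        using i less.prems by (simp add: blocks_def nth_append p_def)
      show "case_sum (\<lambda>k. - coeff F k) (coeff G) k \<in> E" for k
        by (cases k) (auto simp: coeffs)
      show "x j ^ fst (?S ! (m + i)) * y j ^ snd (?S ! (m + i)) =
          (\<Sum>k\<in>{..<b} <+> {..degree G}. case_sum (\<lambda>k. - coeff F k) (coeff G) k *
            (x j ^ fst (w k) * y j ^ snd (w k)))" if "j < n" for j
      proof -
        have "poly F (x j) = (\<Sum>k<b. coeff F k * x j ^ k) + x j ^ b"
          using monic by (simp add: poly_altdef lessThan_Suc_atMost[symmetric])
        then have "x j ^ b * y j = (\<Sum>k<b. - coeff F k * (x j ^ k * y j)) + (\<Sum>k\<le>degree G. coeff G k * x j ^ k)"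
          using linear[OF that]
          by (simp add: algebra_simps poly_altdef sum_distrib_left sum_distrib_right sum_negf)
        then have "x j ^ p * (x j ^ b * y j) =
            x j ^ p * ((\<Sum>k<b. - coeff F k * (x j ^ k * y j)) + (\<Sum>k\<le>degree G. coeff G k * x j ^ k))"
          by (rule arg_cong)
        then show ?thesis unfolding Smi
          by (simp add: w_def sum.Plus power_add algebra_simps sum_distrib_left)
      qed
      show "D (?S[m + i := w k]) \<in> Q" if k: "k \<in> {..<b} <+> {..degree G}" for k
      proof (cases k)
        case (Inl k')
        then have "k' < b" using k by auto
        have "?S[m + i := w k] = blocks [0..<m] (J[i := p + k'])"
          by (simp add: Inl w_def blocks_def list_update_append map_update)
        moreover have "sum_list (J[i := p + k']) < sum_list J"
          using i less.prems \<open>k' < b\<close> elem_le_sum_list[of i J] by (simp add: sum_list_update p_def)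
        ultimately show ?thesis using less by simp
      next
        case (Inr k')
        have "sum_list (map snd ?S) = l" using less.prems by (simp add: blocks_def sum_list_triv o_def)
        then have "sum_list (map snd (?S[m + i := w k])) < l"
          using i Smi len ml by (simp add: map_update sum_list_update Inr w_def)
        then show ?thesis using len by (intro lower) simp_all
      qed
    qed
  qed
qed

lemma D_reduce_degree:
  assumes len: "length S = n" and i: "i < n" "snd (S ! i) = Suc (Suc q)"
    and lower: "\<And>S'. length S' = n \<Longrightarrow> sum_list (map snd S') < sum_list (map snd S) \<Longrightarrow> D S' \<in> Q"
  shows "D S \<in> Q"
proof -
  define p where "p = fst (S ! i)"
  define w where "w = case_sum (\<lambda>k. (p + k, Suc q)) (\<lambda>k. (p + k, q))"
  show ?thesis
  proof (rule D_replace_row[OF len i(1)])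
    show "case_sum (coeff A) (coeff B) k \<in> E" for k
      by (cases k) (auto simp: coeffs)
    show "x j ^ fst (S ! i) * y j ^ snd (S ! i) =
        (\<Sum>k\<in>{..degree A} <+> {..degree B}. case_sum (coeff A) (coeff B) k *
          (x j ^ fst (w k) * y j ^ snd (w k)))" if "j < n" for j
    proof -
      have "x j ^ p * y j ^ q * y j ^ 2 = x j ^ p * y j ^ q *
          ((\<Sum>k\<le>degree A. coeff A k * x j ^ k) * y j + (\<Sum>k\<le>degree B. coeff B k * x j ^ k))"
        unfolding quadratic[OF that] poly_altdef ..
      then show ?thesis
        by (simp add: i p_def w_def sum.Plus power_add power2_eq_square algebra_simps
            sum_distrib_left sum_distrib_right)
    qed
    show "D (S[i := w k]) \<in> Q" for k
    proof (rule lower)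
      have "snd (w k) < snd (S ! i)" by (cases k) (auto simp: w_def i)
      moreover have "snd (S ! i) \<le> sum_list (map snd S)"
        using elem_le_sum_list[of i "map snd S"] len i(1) by simp
      ultimately show "sum_list (map snd (S[i := w k])) < sum_list (map snd S)"
        using len i(1) by (simp add: map_update sum_list_update)
    qed (simp add: len)
  qed
qed

text \<open>
  The induction is on the total degree in \<open>y\<close>. Once no row has degree above \<open>1\<close>, the rows can be sorted
  into the two blocks, since permuting rows changes only the sign of the determinant.
\<close>

theorem D_in_span:
  assumes key: "\<And>l lam. l \<le> b \<Longrightarrow> l \<le> n \<Longrightarrow> lam \<in> Partitions l (b - l) \<Longrightarrow>
      D (blocks (rev [0..<n - l]) (map (\<lambda>i. lam ! i + (l - 1 - i)) [0..<l])) \<in> Q"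
    and "length S = n"
  shows "D S \<in> Q"
  using assms(2)
proof (induction "sum_list (map snd S)" arbitrary: S rule: less_induct)
  case less
  show ?case
  proof (cases "\<exists>i<n. \<exists>q. snd (S ! i) = Suc (Suc q)")
    case True
    then show ?thesis using D_reduce_degree[OF less.prems] less.hyps by blast
  next
    case False
    have snd01: "snd s = 0 \<or> snd s = 1" if s: "s \<in> set S" for s
    proof -
      obtain i where "i < n" "s = S ! i" using s less.prems by (metis in_set_conv_nth)
      with False show ?thesis by (metis One_nat_def not0_implies_Suc)
    qed
    define I where "I = map fst (filter (\<lambda>s. snd s = 0) S)"
    define J where "J = map fst (filter (\<lambda>s. snd s \<noteq> 0) S)"
    have "blocks I J = filter (\<lambda>s. snd s = 0) S @ filter (\<lambda>s. snd s \<noteq> 0) S"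
    proof -
      have "map (\<lambda>i. (i, 0)) I = filter (\<lambda>s. snd s = 0) S"
        unfolding I_def map_map by (rule map_idI) auto
      moreover have "map (\<lambda>i. (i, 1)) J = filter (\<lambda>s. snd s \<noteq> 0) S"
        unfolding J_def map_map by (rule map_idI) (use snd01 in force)
      ultimately show ?thesis by (simp add: blocks_def)
    qed
    then have mset_S: "mset S = mset (blocks I J)"
      by (simp add: multiset_partition)
    then have IJ: "length I + length J = n"
      using mset_eq_length[OF mset_S] less.prems by (simp add: blocks_def)
    have "sum_list (map snd S) = sum_list (map snd (blocks I J))"
      using mset_S by (metis mset_map sum_mset_sum_list)
    then have sum_S: "sum_list (map snd S) = length J"
      by (simp add: blocks_def o_def sum_list_triv)
    have "D (blocks [0..<length I] J') \<in> Q" if J': "length J' = length J" for J'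
    proof (rule D_blocks_reduce[OF IJ _ _ J'])
      show "D S' \<in> Q" if "length S' = n" "sum_list (map snd S') < length J" for S'
        using less.hyps that sum_S by simp
    next
      fix K assume K: "length K = length J" "distinct K" "\<forall>j\<in>set K. j < b"
      let ?K = "rev (sort K)"
      have "sorted_wrt (<) (sort K)" using K(2) by (simp add: strict_sorted_iff)
      then have "sorted_wrt (>) ?K" by (simp add: sorted_wrt_rev)
      then obtain lam where lam: "length J \<le> b" "lam \<in> Partitions (length J) (b - length J)"
        "?K = map (\<lambda>i. lam ! i + (length J - 1 - i)) [0..<length J]"
        by (rule strictly_decreasing_staircase[of ?K "length J" b]) (use K in auto)
      have "D (blocks (rev [0..<length I]) ?K) \<in> Q"
        using key[OF lam(1) _ lam(2)] unfolding lam(3) IJ[symmetric] by simp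
      moreover have "mset (blocks [0..<length I] K) = mset (blocks (rev [0..<length I]) ?K)"
        by (simp add: blocks_def del: mset_upt)
      ultimately show "D (blocks [0..<length I] K) \<in> Q"
        using K IJ by (intro D_cong_mset[of "blocks [0..<length I] K" "blocks (rev [0..<length I]) ?K"])
          (auto simp: blocks_def)
    qed
    then have "D (blocks I J) \<in> Q" by (rule D_blocks[OF IJ _ refl refl])
    then show ?thesis
      using D_cong_mset[OF mset_S] IJ by (simp add: blocks_def)
  qed
qed

end

section \<open>The polynomial ring and its invariants\<close>

text \<open>
  Any total order of the variables makes the monomials an ordered monoid. Products then have
  leading monomials, so the ring of polynomials is recognised as an integral domain.
\<close>

instantiation var :: linorder
begin

definition var_code :: "var \<Rightarrow> nat" where
  "var_code v = (case v of X j \<Rightarrow> 4 * j | Y j \<Rightarrow> 4 * j + 1 | VL k \<Rightarrow> 4 * k + 2 | VR k \<Rightarrow> 4 * k + 3)"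

definition less_eq_var :: "var \<Rightarrow> var \<Rightarrow> bool" where
  "less_eq_var u v \<longleftrightarrow> var_code u \<le> var_code v"

definition less_var :: "var \<Rightarrow> var \<Rightarrow> bool" where
  "less_var u v \<longleftrightarrow> var_code u < var_code v"

instance
proof
  fix u v :: var
  show "u \<le> v \<Longrightarrow> v \<le> u \<Longrightarrow> u = v"
    by (cases u; cases v; simp add: less_eq_var_def var_code_def; presburger)
qed (auto simp: less_eq_var_def less_var_def)

end

lemma Var_inject: "Var u = Var v \<longleftrightarrow> u = v"
proof
  assume "Var u = Var v"
  then have "Poly_Mapping.keys (Var u) = Poly_Mapping.keys (Var v)" by simp
  then have "Poly_Mapping.keys (Poly_Mapping.single u (1::nat)) = Poly_Mapping.keys (Poly_Mapping.single v (1::nat))"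
    by (simp add: Var_def)
  then show "u = v" by simp
qed simp

lemma subst_Var: "subst s (Var v) = s v"
  by (simp add: Var_def subst_single monom_subst_def Const_def)

lemma subst_Const: "subst s (Const c) = Const c"
  by (simp add: Const_def subst_single monom_subst_def)

lemma comm_ring_hom_subst: "comm_ring_hom (subst s)"
  by unfold_locales (simp_all add: subst_zero subst_one subst_add subst_mult)

lemma subst_diff: "subst s (p - q) = subst s p - subst s q"
  using subst_add[of s p "- q"] by (simp add: subst_uminus)

lemma subst_prod: "subst s (prod f A) = (\<Prod>x\<in>A. subst s (f x))"
  by (induction A rule: infinite_finite_induct) (auto simp: subst_one subst_mult)

lemma subst_power: "subst s (p ^ k) = subst s p ^ k"
  by (induction k) (auto simp: subst_one subst_mult)

lemma subst_det: "subst s (det (mat n n f)) = det (mat n n (\<lambda>(i, j). subst s (f (i, j))))"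
proof -
  interpret comm_ring_hom "subst s" by (rule comm_ring_hom_subst)
  show ?thesis unfolding hom_det[symmetric] by (intro arg_cong[of _ _ det] eq_matI) auto
qed

lemma polys_on_Var: "v \<in> A \<Longrightarrow> Var v \<in> polys_on A"
  by (simp add: polys_on_iff Var_def)

lemma polys_on_diff: "p \<in> polys_on A \<Longrightarrow> q \<in> polys_on A \<Longrightarrow> p - q \<in> polys_on A"
  using polys_on_add[of p A "- q"] by (simp add: polys_on_uminus)

lemma polys_on_Const: "Const c \<in> polys_on A"
  by (simp add: polys_on_iff Const_def)

text \<open>Used both for polynomial rings on a set of variables and for the ring of invariants.\<close>

lemma det_closed:
  fixes R :: "'r::comm_ring_1 set"
  assumes add: "\<And>p q. p \<in> R \<Longrightarrow> q \<in> R \<Longrightarrow> p + q \<in> R"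
    and mult: "\<And>p q. p \<in> R \<Longrightarrow> q \<in> R \<Longrightarrow> p * q \<in> R"
    and uminus: "\<And>p. p \<in> R \<Longrightarrow> - p \<in> R" and one: "1 \<in> R" "0 \<in> R"
    and M: "\<And>i j. i < n \<Longrightarrow> j < n \<Longrightarrow> f (i, j) \<in> R"
  shows "det (mat n n f) \<in> R"
proof -
  have sum: "sum g K \<in> R" if "\<And>k. k \<in> K \<Longrightarrow> g k \<in> R" for g :: "(nat \<Rightarrow> nat) \<Rightarrow> 'r" and K
    using that by (induction K rule: infinite_finite_induct) (auto intro: one add)
  have prod: "prod g K \<in> R" if "\<And>k. k \<in> K \<Longrightarrow> g k \<in> R" for g :: "nat \<Rightarrow> 'r" and K
    using that by (induction K rule: infinite_finite_induct) (auto intro: one mult)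
  have lt: "p i < n" if "p permutes {0..<n}" "i < n" for p i
    using permutes_in_image[OF that(1), of i] that by simp
  have "det (mat n n f) = (\<Sum>p | p permutes {0..<n}. signof p * (\<Prod>i = 0..<n. f (i, p i)))"
    by (subst det_def'[of _ n]) (auto intro!: sum.cong simp: lt)
  also have "\<dots> \<in> R"
  proof (rule sum)
    fix p assume p: "p \<in> {p. p permutes {0..<n}}"
    have "(\<Prod>i = 0..<n. f (i, p i)) \<in> R" by (intro prod M) (use p lt in auto)
    then show "signof p * (\<Prod>i = 0..<n. f (i, p i)) \<in> R"
      by (auto simp: sign_def uminus)
  qed
  finally show ?thesis .
qed

lemma polys_on_one_zero: "1 \<in> polys_on A" "0 \<in> polys_on A"
  by (simp_all add: polys_on_iff)

lemma polys_on_power: "p \<in> polys_on A \<Longrightarrow> p ^ k \<in> polys_on A"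
  by (induction k) (auto intro: polys_on_one_zero polys_on_mult)

lemma polys_on_prod: "(\<And>k. k \<in> K \<Longrightarrow> f k \<in> polys_on A) \<Longrightarrow> prod f K \<in> polys_on A"
  by (induction K rule: infinite_finite_induct) (auto intro: polys_on_one_zero polys_on_mult)

lemma polys_on_sum: "(\<And>k. k \<in> K \<Longrightarrow> f k \<in> polys_on A) \<Longrightarrow> sum f K \<in> polys_on A"
  by (induction K rule: infinite_finite_induct) (auto intro: polys_on_one_zero polys_on_add)

lemma act_VL: "act \<pi> (Var (VL k)) = Var (VL k)"
  and act_VR: "act \<pi> (Var (VR k)) = Var (VR k)"
  by (simp_all add: act_def subst_Var)

lemma Eab_Const: "Const c \<in> Eab a b"
  by (simp add: Eab_def act_def subst_Const polys_on_Const)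

lemma Eab_V: "k < a \<Longrightarrow> Var (VL k) \<in> Eab a b" "k < b \<Longrightarrow> Var (VR k) \<in> Eab a b"
  by (simp_all add: Eab_def act_VL act_VR polys_on_Var XV_vars_def)

lemma Eab_sum: "(\<And>k. k \<in> K \<Longrightarrow> f k \<in> Eab a b) \<Longrightarrow> sum f K \<in> Eab a b"
  by (induction K rule: infinite_finite_induct) (auto intro: Eab_zero_one Eab_closed)

lemma young_permutes:
  fixes a b :: nat
  assumes "\<sigma> permutes {..<a}" "\<tau> permutes {a..<a + b}"
  shows "(\<sigma> \<circ> \<tau>) permutes {..<a + b}" "(\<sigma> \<circ> \<tau>) ` {..<a} = {..<a}"
    "(\<sigma> \<circ> \<tau>) ` {a..<a + b} = {a..<a + b}"
proof -
  have "\<sigma> permutes {..<a + b}" by (rule permutes_subset[OF assms(1)]) auto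
  moreover have "\<tau> permutes {..<a + b}" by (rule permutes_subset[OF assms(2)]) auto
  ultimately show "(\<sigma> \<circ> \<tau>) permutes {..<a + b}" by (rule permutes_compose[rotated])
  have "\<tau> ` {..<a} = {..<a}" using assms(2) by (force simp: permutes_def image_iff)
  then show "(\<sigma> \<circ> \<tau>) ` {..<a} = {..<a}"
    using permutes_image[OF assms(1)] by (simp only: image_comp[symmetric])
  have "\<sigma> ` {a..<a + b} = {a..<a + b}" using assms(1) by (force simp: permutes_def image_iff)
  then show "(\<sigma> \<circ> \<tau>) ` {a..<a + b} = {a..<a + b}"
    using permutes_image[OF assms(2)] by (simp only: image_comp[symmetric])
qed

lemma Eab_esym: "(\<Sum>R | R \<subseteq> {0..<a + b} \<and> card R = r. \<Prod>j\<in>R. Var (X j)) \<in> Eab a b"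
proof -
  have "act (\<sigma> \<circ> \<tau>) (\<Sum>R | R \<subseteq> {0..<a + b} \<and> card R = r. \<Prod>j\<in>R. Var (X j)) =
      (\<Sum>R | R \<subseteq> {0..<a + b} \<and> card R = r. \<Prod>j\<in>R. Var (X j))"
    if "\<sigma> permutes {..<a}" "\<tau> permutes {a..<a + b}" for \<sigma> \<tau>
  proof -
    have "(\<sigma> \<circ> \<tau>) permutes {0..<a + b}"
      using young_permutes(1)[OF that] by (simp add: atLeast0LessThan)
    from esym_invariant[OF this, of "\<lambda>j. Var (X j)" r] show ?thesis
      by (simp add: act_def subst_sum subst_prod subst_Var)
  qed
  moreover have "(\<Sum>R | R \<subseteq> {0..<a + b} \<and> card R = r. \<Prod>j\<in>R. Var (X j)) \<in> polys_on (XV_vars a b)"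
    by (intro polys_on_sum polys_on_prod polys_on_Var) (auto simp: XV_vars_def)
  ultimately show ?thesis by (simp add: Eab_def)
qed

definition root_poly :: "nat set \<Rightarrow> qpoly poly" where
  "root_poly A = (\<Prod>i\<in>A. [:- Var (X i), 1:])"

lemma root_poly_root: "finite A \<Longrightarrow> j \<in> A \<Longrightarrow> poly (root_poly A) (Var (X j)) = 0"
  by (auto simp: root_poly_def poly_prod intro!: prod_zero bexI[of _ j])

lemma root_poly_monic: "lead_coeff (root_poly A) = 1"
  by (simp add: root_poly_def lead_coeff_prod)

lemma root_poly_degree: "degree (root_poly A) = card A"
  unfolding root_poly_def by (subst degree_prod_eq_sum_degree) auto

lemma coeff_mult_closed:
  fixes p q :: "qpoly poly"
  assumes "\<And>k. coeff p k \<in> Eab a b" "\<And>k. coeff q k \<in> Eab a b"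
  shows "coeff (p * q) k \<in> Eab a b"
  unfolding coeff_mult using assms by (intro Eab_sum Eab_closed)

text \<open>
  The permutations in question map each block to itself, so they only reorder the linear factors.
\<close>

lemma Eab_root_poly:
  assumes A: "A \<in> {{..<a}, {a..<a + b}}"
  shows "coeff (root_poly A) k \<in> Eab a b"
proof -
  have inv: "act (\<sigma> \<circ> \<tau>) (coeff (root_poly A) k) = coeff (root_poly A) k"
    if st: "\<sigma> permutes {..<a}" "\<tau> permutes {a..<a + b}" for \<sigma> \<tau>
  proof -
    have "finite A" using A by auto
    then have "act (\<sigma> \<circ> \<tau>) (coeff (root_poly A) k) =
        coeff (\<Prod>i\<in>A. [:- Var (X ((\<sigma> \<circ> \<tau>) i)), 1:]) k"
      unfolding root_poly_def
    proof (induction A arbitrary: k rule: finite_induct)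
      case empty
      then show ?case by (simp add: coeff_1 act_def subst_one subst_zero)
    next
      case (insert i A)
      then show ?case
        by (cases k) (simp_all add: act_def subst_add subst_diff subst_mult subst_uminus subst_Var)
    qed
    also have "(\<Prod>i\<in>A. [:- Var (X ((\<sigma> \<circ> \<tau>) i)), 1:]) = (\<Prod>i\<in>(\<sigma> \<circ> \<tau>) ` A. [:- Var (X i), 1:])"
      by (subst prod.reindex[OF permutes_inj_on[OF young_permutes(1)[OF st]]]) (simp add: o_def)
    also have "(\<sigma> \<circ> \<tau>) ` A = A" using A young_permutes(2,3)[OF st] by auto
    finally show ?thesis unfolding root_poly_def .
  qed
  have "coeff (root_poly A) k \<in> polys_on (XV_vars a b)"
  proof -
    have "coeff (\<Prod>i\<in>B. [:- Var (X i), 1:]) k \<in> polys_on (XV_vars a b)" if "finite B" "B \<subseteq> {..<a + b}" for B k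
      using that
    proof (induction B arbitrary: k rule: finite_induct)
      case empty
      then show ?case by (auto simp: coeff_1 intro: polys_on_one_zero)
    next
      case (insert i B)
      then show ?case
        by (auto simp: coeff_pCons XV_vars_def split: nat.splits intro!: polys_on_diff polys_on_uminus polys_on_mult polys_on_Var polys_on_one_zero)
    qed
    moreover have "finite A" "A \<subseteq> {..<a + b}" using A by auto
    ultimately show ?thesis by (simp add: root_poly_def)
  qed
  with inv show ?thesis by (simp add: Eab_def)
qed

section \<open>Divisibility by the Vandermonde determinants\<close>

definition y_left :: "nat \<Rightarrow> qpoly poly" where
  "y_left a = (\<Sum>k<a. monom (Var (VL k)) k)"

definition y_right :: "nat \<Rightarrow> qpoly poly" where
  "y_right b = (\<Sum>k<b. monom (Var (VR k)) k)"

text \<open>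
  Written with values of polynomials in one variable, so that the relations between \<open>x\<close> and \<open>y\<close> on
  each block become identities between such polynomials.
\<close>

definition embedded_y :: "nat \<Rightarrow> nat \<Rightarrow> nat \<Rightarrow> qpoly" where
  "embedded_y a b j = (if j < a then poly (y_left a) (Var (X j)) else poly (y_right b) (Var (X j)))"

lemma coeff_y_left: "coeff (y_left a) k \<in> Eab a b"
  unfolding y_left_def coeff_sum by (intro Eab_sum) (auto simp: Eab_V Eab_zero_one)

lemma coeff_y_right: "coeff (y_right b) k \<in> Eab a b"
  unfolding y_right_def coeff_sum by (intro Eab_sum) (auto simp: Eab_V Eab_zero_one)

lemma embed_Delta:
  assumes "length S = n"
  shows "embed a b (Delta S) =
    det (mat n n (\<lambda>(i, j). Var (X j) ^ fst (S ! i) * embedded_y a b j ^ snd (S ! i)))"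
  unfolding Delta_def embed_def assms subst_det
  by (intro arg_cong[of _ _ det] cong_mat)
     (auto simp: subst_mult subst_power subst_Var embedded_y_def y_left_def y_right_def poly_sum poly_monom mult.commute)

text \<open>
  Division by the monic polynomial with roots \<open>X j\<close> for \<open>j\<close> in the block. It is carried out on the
  values at these roots: from the representation of $x^p$ that of $x^{p+1}$ follows by
  rewriting the single overflowing power $x^d$, where $d$ is the size of the block.
\<close>

lemma remainder_mod_root_poly:
  assumes A: "A \<in> {{..<a}, {a..<a + b}}" and P: "\<And>k. coeff P k \<in> Eab a b"
  shows "\<exists>c. (\<forall>k. c k \<in> Eab a b) \<and>
    (\<forall>j\<in>A. poly P (Var (X j)) = (\<Sum>k<card A. c k * Var (X j) ^ k))"
proof -
  let ?d = "card A"
  have "\<exists>c. (\<forall>k. c k \<in> Eab a b) \<and> (\<forall>j\<in>A. Var (X j) ^ p = (\<Sum>k<?d. c k * Var (X j) ^ k))" for p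
  proof (cases "A = {}")
    case True
    then show ?thesis using Eab_zero_one by (intro exI[of _ "\<lambda>_. 0"]) auto
  next
    case False
    have fin: "finite A" using A by auto
    then obtain d where d: "?d = Suc d" using False by (metis card_eq_0_iff not0_implies_Suc)
    show ?thesis
    proof (induction p)
      case 0
      show ?case using Eab_zero_one
        by (intro exI[of _ "\<lambda>k. if k = 0 then 1 else 0"])
           (simp add: if_distrib[of "\<lambda>z. z * _"] d cong: if_cong)
    next
      case (Suc p)
      then obtain c where c: "\<And>k. c k \<in> Eab a b"
        and eq: "\<And>j. j \<in> A \<Longrightarrow> Var (X j) ^ p = (\<Sum>k<?d. c k * Var (X j) ^ k)" by blast
      \<comment> \<open>Shift the coefficients by one and reduce \<open>c d * x ^ Suc d\<close>.\<close>
      define c' where "c' k = (if k = 0 then 0 else c (k - 1)) + - (c d * coeff (root_poly A) k)" for k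
      have "Var (X j) ^ Suc p = (\<Sum>k<?d. c' k * Var (X j) ^ k)" if j: "j \<in> A" for j
      proof -
        let ?x = "Var (X j)"
        have "(\<Sum>k<?d. coeff (root_poly A) k * ?x ^ k) + ?x ^ ?d = 0"
          using root_poly_root[OF fin j] root_poly_monic[of A]
          by (simp add: poly_altdef root_poly_degree lessThan_Suc_atMost[symmetric])
        then have top: "?x ^ ?d = - (\<Sum>k<?d. coeff (root_poly A) k * ?x ^ k)"
          by (simp add: eq_neg_iff_add_eq_0 add.commute)
        have "?x ^ Suc p = (\<Sum>k<d. c k * ?x ^ Suc k) + c d * ?x ^ ?d"
          unfolding power_Suc2 eq[OF j] d by (simp add: sum_distrib_left algebra_simps)
        also have "(\<Sum>k<d. c k * ?x ^ Suc k) = (\<Sum>k<?d. (if k = 0 then 0 else c (k - 1)) * ?x ^ k)"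
          unfolding d by (subst sum.lessThan_Suc_shift) simp
        also have "\<dots> + c d * ?x ^ ?d = (\<Sum>k<?d. c' k * ?x ^ k)"
          unfolding top c'_def
          by (simp add: left_diff_distrib sum_subtractf sum_distrib_left mult.assoc)
        finally show ?thesis .
      qed
      moreover have "c' k \<in> Eab a b" for k
        unfolding c'_def using c Eab_root_poly[OF A] Eab_zero_one
        by (intro Eab_closed(1) Eab_closed(3) Eab_closed(2)) auto
      ultimately show ?case by blast
    qed
  qed
  then obtain c where c: "\<And>p k. c p k \<in> Eab a b"
    "\<And>p j. j \<in> A \<Longrightarrow> Var (X j) ^ p = (\<Sum>k<?d. c p k * Var (X j) ^ k)" by metis
  let ?c = "\<lambda>k. \<Sum>p\<le>degree P. coeff P p * c p k"
  have "poly P (Var (X j)) = (\<Sum>k<?d. ?c k * Var (X j) ^ k)" if "j \<in> A" for j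
  proof -
    have "poly P (Var (X j)) = (\<Sum>p\<le>degree P. coeff P p * (\<Sum>k<?d. c p k * Var (X j) ^ k))"
      unfolding poly_altdef by (intro sum.cong refl arg_cong[of _ _ "(*) _"] c(2)[OF that])
    also have "\<dots> = (\<Sum>k<?d. ?c k * Var (X j) ^ k)"
      unfolding sum_distrib_left sum_distrib_right by (subst sum.swap) (simp add: mult.assoc)
    finally show ?thesis .
  qed
  moreover have "?c k \<in> Eab a b" for k using P c(1) by (intro Eab_sum Eab_closed(2))
  ultimately show ?thesis by (intro exI[of _ ?c]) simp
qed

lemma coeff_monom_power_closed:
  assumes "\<And>k. coeff P k \<in> Eab a b"
  shows "coeff (monom 1 p * P ^ q) k \<in> Eab a b"
proof -
  have "coeff (P ^ q) k \<in> Eab a b" for k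
    using assms by (induction q arbitrary: k)
      (auto simp: coeff_1 Eab_zero_one intro!: coeff_mult_closed)
  then show ?thesis by (auto simp: coeff_monom_mult Eab_zero_one)
qed

lemma sum_lessThan_add:
  fixes f :: "nat \<Rightarrow> 'r::comm_monoid_add"
  shows "(\<Sum>k<a + b. f k) = (\<Sum>k<a. f k) + (\<Sum>k<b. f (a + k))"
  by (induction b) (simp_all add: add.assoc)

text \<open>
  Row \<open>i\<close> of the matrix restricts on each block to a polynomial in \<open>x\<close> with coefficients in
  \<open>Eab a b\<close>. Its remainders form row \<open>i\<close> of a matrix \<open>N\<close>, and the original matrix is \<open>N\<close> times the block
  diagonal matrix of the two Vandermonde matrices. Thus the quotient is \<open>det N\<close>.
\<close>

lemma Delta_quotient:
  assumes S: "length S = a + b"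
  shows "\<exists>q\<in>Eab a b. q * (vandermonde 0 a * vandermonde a b) = embed a b (Delta S)"
proof -
  let ?n = "a + b"
  let ?PL = "\<lambda>i. monom 1 (fst (S ! i)) * y_left a ^ snd (S ! i)"
  let ?PR = "\<lambda>i. monom 1 (fst (S ! i)) * y_right b ^ snd (S ! i)"
  have "\<exists>c. (\<forall>k. c k \<in> Eab a b) \<and>
      (\<forall>j\<in>{..<a}. poly (?PL i) (Var (X j)) = (\<Sum>k<a. c k * Var (X j) ^ k))" for i
    using remainder_mod_root_poly[of "{..<a}" a b "?PL i"] coeff_monom_power_closed[OF coeff_y_left] by auto
  then have "\<exists>c. \<forall>i. (\<forall>k. c i k \<in> Eab a b) \<and>
      (\<forall>j\<in>{..<a}. poly (?PL i) (Var (X j)) = (\<Sum>k<a. c i k * Var (X j) ^ k))"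
    by (intro choice allI)
  then obtain cL where cL: "\<And>i k. cL i k \<in> Eab a b"
    "\<And>i j. j < a \<Longrightarrow> poly (?PL i) (Var (X j)) = (\<Sum>k<a. cL i k * Var (X j) ^ k)"
    by blast
  have "\<exists>c. (\<forall>k. c k \<in> Eab a b) \<and>
      (\<forall>j\<in>{a..<a + b}. poly (?PR i) (Var (X j)) = (\<Sum>k<b. c k * Var (X j) ^ k))" for i
    using remainder_mod_root_poly[of "{a..<a + b}" a b "?PR i"] coeff_monom_power_closed[OF coeff_y_right] by auto
  then have "\<exists>c. \<forall>i. (\<forall>k. c i k \<in> Eab a b) \<and>
      (\<forall>j\<in>{a..<a + b}. poly (?PR i) (Var (X j)) = (\<Sum>k<b. c i k * Var (X j) ^ k))"
    by (intro choice allI)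
  then obtain cR where cR: "\<And>i k. cR i k \<in> Eab a b"
    "\<And>i j. a \<le> j \<Longrightarrow> j < a + b \<Longrightarrow> poly (?PR i) (Var (X j)) = (\<Sum>k<b. cR i k * Var (X j) ^ k)"
    by (meson atLeastLessThan_iff)
  define N where "N = mat ?n ?n (\<lambda>(i, k). if k < a then cL i k else cR i (k - a))"
  define BL where "BL = mat a a (\<lambda>(i, j). Var (X (0 + j)) ^ i)"
  define BR where "BR = mat b b (\<lambda>(i, j). Var (X (a + j)) ^ i)"
  define W where "W = four_block_mat BL (0\<^sub>m a b) (0\<^sub>m b a) BR"
  have W_carrier: "W \<in> carrier_mat ?n ?n" by (simp add: W_def BL_def BR_def)
  have W: "W $$ (k, j) = (if k < a then if j < a then Var (X j) ^ k else 0
      else if j < a then 0 else Var (X j) ^ (k - a))" if "k < ?n" "j < ?n" for k j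
    using that by (simp add: W_def BL_def BR_def)
  have "mat ?n ?n (\<lambda>(i, j). Var (X j) ^ fst (S ! i) * embedded_y a b j ^ snd (S ! i)) = N * W"
  proof (rule eq_matI)
    fix i j assume "i < dim_row (N * W)" "j < dim_col (N * W)"
    then have ij: "i < ?n" "j < ?n" using W_carrier by (auto simp: N_def)
    have "(N * W) $$ (i, j) = (\<Sum>k<?n. N $$ (i, k) * W $$ (k, j))"
      using ij W_carrier by (simp add: N_def scalar_prod_def atLeast0LessThan)
    also have "\<dots> = (\<Sum>k<a. N $$ (i, k) * W $$ (k, j)) + (\<Sum>k<b. N $$ (i, a + k) * W $$ (a + k, j))"
      by (simp add: sum_lessThan_add)
    also have "\<dots> = Var (X j) ^ fst (S ! i) * embedded_y a b j ^ snd (S ! i)"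
    proof (cases "j < a")
      case True
      then show ?thesis
        using ij cL(2)[OF True, of i] by (simp add: N_def W embedded_y_def poly_monom)
    next
      case False
      then show ?thesis
        using ij cR(2)[of j i] by (simp add: N_def W embedded_y_def poly_monom)
    qed
    finally show "mat ?n ?n (\<lambda>(i, j). Var (X j) ^ fst (S ! i) * embedded_y a b j ^ snd (S ! i)) $$ (i, j) =
        (N * W) $$ (i, j)" using ij by simp
  qed (use W_carrier in \<open>auto simp: N_def\<close>)
  then have "embed a b (Delta S) = det N * det W"
    using embed_Delta[OF S] det_mult[of N ?n W] W_carrier by (simp add: N_def)
  also have "det W = vandermonde 0 a * vandermonde a b"
    unfolding W_def
    by (subst det_four_block_mat_lower_left_zero) (auto simp: BL_def BR_def vandermonde_def)
  finally have "det N * (vandermonde 0 a * vandermonde a b) = embed a b (Delta S)" ..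
  moreover have "det N \<in> Eab a b"
    unfolding N_def by (rule det_closed) (auto simp: Eab_closed Eab_zero_one cL cR)
  ultimately show ?thesis by blast
qed

text \<open>
  A linear dependence of the rows would be a nonzero polynomial of degree below \<open>n\<close> that vanishes at
  \<open>n\<close> distinct variables.
\<close>

lemma vandermonde_nonzero: "vandermonde m n \<noteq> 0"
proof
  let ?V = "mat n n (\<lambda>(i, j). Var (X (m + j)) ^ i)"
  assume "vandermonde m n = 0"
  then have "det (transpose_mat ?V) = 0"
    using det_transpose[of ?V n] by (simp add: vandermonde_def)
  moreover have "transpose_mat ?V \<in> carrier_mat n n" by simp
  ultimately obtain v where v: "v \<in> carrier_vec n" "v \<noteq> 0\<^sub>v n" "transpose_mat ?V *\<^sub>v v = 0\<^sub>v n"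
    using det_0_iff_vec_prod_zero by blast
  define P where "P = (\<Sum>i<n. monom (v $ i) i)"
  have coeff_P: "coeff P i = (if i < n then v $ i else 0)" for i
    by (auto simp: P_def coeff_sum)
  have "\<exists>i<n. v $ i \<noteq> 0"
  proof (rule ccontr)
    assume "\<not> (\<exists>i<n. v $ i \<noteq> 0)"
    then have "v = 0\<^sub>v n" using v(1) by (intro eq_vecI) auto
    with v(2) show False ..
  qed
  then obtain i where i: "i < n" "v $ i \<noteq> 0" by blast
  then have "P \<noteq> 0" using coeff_P[of i] by auto
  have "degree P < n"
    using i coeff_P \<open>P \<noteq> 0\<close> by (metis leading_coeff_0_iff)
  have "poly P (Var (X (m + j))) = 0" if j: "j < n" for j
  proof -
    have "(transpose_mat ?V *\<^sub>v v) $ j = poly P (Var (X (m + j)))"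
      using j v(1) by (simp add: P_def poly_sum poly_monom scalar_prod_def atLeast0LessThan mult.commute)
    then show ?thesis using v(3) j by simp
  qed
  then have "(\<lambda>j. Var (X (m + j))) ` {..<n} \<subseteq> {x. poly P x = 0}" by auto
  moreover have "card ((\<lambda>j. Var (X (m + j))) ` {..<n}) = n"
    by (subst card_image) (auto simp: inj_on_def Var_inject)
  ultimately have "n \<le> card {x. poly P x = 0}"
    using card_mono[OF poly_roots_finite[OF \<open>P \<noteq> 0\<close>]] by metis
  also have "\<dots> \<le> degree P" using \<open>P \<noteq> 0\<close> by (rule card_poly_roots_bound)
  finally show False using \<open>degree P < n\<close> by simp
qed

section \<open>The ideal of antisymmetric polynomials\<close>

lemma Delta_antisymmetric:
  assumes S: "length S = a + b"
  shows "Delta S \<in> antisymmetric a b"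
proof -
  let ?n = "a + b"
  let ?M = "mat ?n ?n (\<lambda>(i, j). Var (X j) ^ fst (S ! i) * Var (Y j) ^ snd (S ! i))"
  have "Delta S \<in> polys_on (XY_vars a b)"
    unfolding Delta_def S
    by (rule det_closed)
      (auto simp: XY_vars_def intro!: polys_on_add polys_on_mult polys_on_uminus polys_on_one_zero polys_on_power polys_on_Var)
  moreover have "act \<pi> (Delta S) = of_int (sign \<pi>) * Delta S" if \<pi>: "\<pi> permutes {..<?n}" for \<pi>
  proof -
    have \<pi>': "\<pi> permutes {0..<?n}" using \<pi> by (simp add: atLeast0LessThan)
    have lt: "\<pi> j < ?n" if "j < ?n" for j using permutes_in_image[OF \<pi>, of j] that by simp
    have "act \<pi> (Delta S) = det (mat ?n ?n (\<lambda>(i, j). ?M $$ (i, \<pi> j)))"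
      unfolding Delta_def act_def S subst_det
      by (intro arg_cong[of _ _ det] cong_mat) (auto simp: subst_mult subst_power subst_Var lt)
    also have "\<dots> = det (mat ?n ?n (\<lambda>(i, j). transpose_mat ?M $$ (\<pi> i, j)))"
      by (subst det_transpose[of _ ?n, symmetric]) (auto intro!: arg_cong[of _ _ det] eq_matI simp: lt)
    also have "\<dots> = of_int (sign \<pi>) * det (transpose_mat ?M)"
      by (rule det_permute_rows[OF _ \<pi>']) simp
    also have "det (transpose_mat ?M) = Delta S"
      by (subst det_transpose[of _ ?n]) (auto simp: Delta_def S)
    finally show ?thesis .
  qed
  ultimately show ?thesis by (simp add: antisymmetric_def)
qed

text \<open>
  Summing $\mathrm{sgn}(\pi)\, \pi f = f$ over all $\pi$ antisymmetrises each monomial of $f$, and the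
  antisymmetrisation of $\prod_j x_j^{\alpha_j} y_j^{\beta_j}$ is the Leibniz expansion of
  $\Delta_S$ for $S = ((\alpha_j, \beta_j))_j$.
\<close>

lemma antisymmetric_expansion:
  assumes f: "f \<in> antisymmetric a b"
  shows "of_nat (fact (a + b)) * f = (\<Sum>m\<in>Poly_Mapping.keys f. Const (Poly_Mapping.lookup f m) *
    Delta (map (\<lambda>j. (Poly_Mapping.lookup m (X j), Poly_Mapping.lookup m (Y j))) [0..<a + b]))"
proof -
  let ?n = "a + b"
  let ?P = "{\<pi>. \<pi> permutes {0..<?n}}"
  let ?S = "\<lambda>m. map (\<lambda>j. (Poly_Mapping.lookup m (X j), Poly_Mapping.lookup m (Y j))) [0..<?n]"
  let ?T = "\<lambda>\<pi> m. \<Prod>j = 0..<?n. Var (X (\<pi> j)) ^ Poly_Mapping.lookup m (X j) * Var (Y (\<pi> j)) ^ Poly_Mapping.lookup m (Y j)"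
  have on: "f \<in> polys_on (XY_vars a b)" using f by (simp add: antisymmetric_def)
  have act: "act \<pi> f = (\<Sum>m\<in>Poly_Mapping.keys f. Const (Poly_Mapping.lookup f m) * ?T \<pi> m)" for \<pi>
    unfolding act_def subst_def
  proof (intro sum.cong refl arg_cong[of _ _ "(*) _"])
    fix m assume "m \<in> Poly_Mapping.keys f"
    then have sub: "Poly_Mapping.keys m \<subseteq> X ` {0..<?n} \<union> Y ` {0..<?n}"
      using on by (auto simp: polys_on_iff XY_vars_def atLeast0LessThan)
    show "monom_subst (\<lambda>v. case v of X j \<Rightarrow> Var (X (\<pi> j)) | Y j \<Rightarrow> Var (Y (\<pi> j))
        | VL k \<Rightarrow> Var (VL k) | VR k \<Rightarrow> Var (VR k)) m = ?T \<pi> m"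
      unfolding monom_subst_superset[OF finite_UnI[OF finite_imageI finite_imageI, OF finite_atLeastLessThan finite_atLeastLessThan] sub] prod.distrib
      by (subst prod.union_disjoint) (auto simp: prod.reindex inj_on_def)
  qed
  have sgn: "of_int (sign \<pi>) * act \<pi> f = f" if "\<pi> \<in> ?P" for \<pi>
  proof -
    have "act \<pi> f = of_int (sign \<pi>) * f"
      using f that by (auto simp: antisymmetric_def atLeast0LessThan)
    then show ?thesis by (simp add: sign_def)
  qed
  have Delta: "Delta (?S m) = (\<Sum>\<pi>\<in>?P. of_int (sign \<pi>) * ?T \<pi> m)" for m
  proof -
    have lt: "\<pi> i < ?n" if "\<pi> permutes {0..<?n}" "i < ?n" for \<pi> i
      using permutes_in_image[OF that(1), of i] that by simp
    show ?thesis unfolding Delta_def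
      by (subst det_def'[of _ ?n])
        (auto intro!: sum.cong prod.cong simp: lt simp del: upt_Suc)
  qed
  have "of_nat (fact ?n) * f = (\<Sum>\<pi>\<in>?P. of_int (sign \<pi>) * act \<pi> f)"
    using card_permutations[of "{0..<?n}" ?n] by (simp add: sgn)
  also have "\<dots> = (\<Sum>m\<in>Poly_Mapping.keys f. Const (Poly_Mapping.lookup f m) * Delta (?S m))"
    unfolding act Delta sum_distrib_left
    by (subst sum.swap) (simp add: mult_ac)
  finally show ?thesis .
qed

lemma of_nat_Const: "of_nat n = Const (of_nat n)"
  by (induction n) (simp_all add: Const_add, simp_all add: Const_def)

lemma E_ring_ideal:
  assumes "ideal J (E_ring a b)"
  shows "0 \<in> J" "p \<in> J \<Longrightarrow> q \<in> J \<Longrightarrow> p + q \<in> J" "c \<in> Eab a b \<Longrightarrow> p \<in> J \<Longrightarrow> c * p \<in> J"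
    "p \<in> J \<Longrightarrow> - p \<in> J"
proof -
  interpret ideal J "E_ring a b" by (rule assms)
  show "0 \<in> J" using additive_subgroup.zero_closed[OF additive_subgroup_axioms] by (simp add: E_ring_def)
  show "p + q \<in> J" if "p \<in> J" "q \<in> J" using additive_subgroup.a_closed[OF additive_subgroup_axioms that] by (simp add: E_ring_def)
  have mult: "c * p \<in> J" if "c \<in> Eab a b" "p \<in> J" for c p
    using I_l_closed[OF that(2), of c] that(1) by (simp add: E_ring_def)
  then show "c \<in> Eab a b \<Longrightarrow> p \<in> J \<Longrightarrow> c * p \<in> J" .
  show "p \<in> J \<Longrightarrow> - p \<in> J"
    using mult[of "- 1" p] Eab_closed(3)[OF Eab_zero_one(2)] by simp
qed

text \<open>
  The abstract spanning theorem applied to the \<open>Eab a b\<close>-module of all multiples \<open>q * V\<close> with \<open>q \<in> J\<close>,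
  where \<open>V\<close> is the product of the two Vandermonde determinants.
\<close>

lemma embed_Delta_in_key_multiples:
  assumes J: "ideal J (E_ring a b)"
    and key: "quotients a b {Delta (Key a b l lam) | l lam. l \<le> b \<and> lam \<in> Partitions l (b - l)} \<subseteq> J"
    and S: "length S = a + b"
  shows "\<exists>q\<in>J. embed a b (Delta S) = q * (vandermonde 0 a * vandermonde a b)"
proof -
  let ?V = "vandermonde 0 a * vandermonde a b"
  define Q where "Q = (\<lambda>q. q * ?V) ` J"
  let ?F = "root_poly {a..<a + b}"
  interpret bialternant_span "a + b" b "\<lambda>j. Var (X j)" "embedded_y a b" "Eab a b" Q
    "y_left a + y_right b" "- (y_left a * y_right b)" ?F "?F * y_left a"
  proof
    show "0 \<in> Q" unfolding Q_def using E_ring_ideal(1)[OF J] by force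
    show "p + q \<in> Q" if "p \<in> Q" "q \<in> Q" for p q
      using that E_ring_ideal(2)[OF J] unfolding Q_def by (auto simp: distrib_right[symmetric])
    show "- p \<in> Q" if "p \<in> Q" for p
      using that E_ring_ideal(4)[OF J] unfolding Q_def by (auto simp: minus_mult_left simp del: mult_minus_left)
    show "c * p \<in> Q" if "c \<in> Eab a b" "p \<in> Q" for c p
      using that E_ring_ideal(3)[OF J] unfolding Q_def by (auto simp: mult.assoc[symmetric] intro!: imageI)
    show "(\<Sum>R | R \<subseteq> {0..<a + b} \<and> card R = r. \<Prod>j\<in>R. Var (X j)) \<in> Eab a b" for r
      by (rule Eab_esym)
    have F: "coeff ?F k \<in> Eab a b" for k by (rule Eab_root_poly) simp
    show "coeff (y_left a + y_right b) k \<in> Eab a b" "coeff (- (y_left a * y_right b)) k \<in> Eab a b"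
      "- coeff ?F k \<in> Eab a b" "coeff (?F * y_left a) k \<in> Eab a b" for k
      using F by (auto intro!: Eab_closed coeff_mult_closed coeff_y_left coeff_y_right)
    show "embedded_y a b j ^ 2 = poly (y_left a + y_right b) (Var (X j)) * embedded_y a b j + poly (- (y_left a * y_right b)) (Var (X j))" for j
      by (simp add: embedded_y_def power2_eq_square algebra_simps)
    show "degree ?F = b" by (simp add: root_poly_degree)
    show "lead_coeff ?F = 1" by (rule root_poly_monic)
    show "poly ?F (Var (X j)) * embedded_y a b j = poly (?F * y_left a) (Var (X j))" if "j < a + b" for j
      using that root_poly_root[of "{a..<a + b}" j] by (cases "j < a") (auto simp: embedded_y_def)
  qed
  have D: "D T = embed a b (Delta T)" if "length T = a + b" for T
    unfolding D_def embed_Delta[OF that] ..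
  have "D S \<in> Q"
  proof (rule D_in_span[OF _ S])
    fix l lam assume l: "l \<le> b" "lam \<in> Partitions l (b - l)"
    have Key: "blocks (rev [0..<a + b - l]) (map (\<lambda>i. lam ! i + (l - 1 - i)) [0..<l]) = Key a b l lam"
      by (simp add: blocks_def Key_def o_def)
    have len: "length (Key a b l lam) = a + b" using l by (simp add: Key_def)
    obtain q where q: "q \<in> Eab a b" "q * ?V = embed a b (Delta (Key a b l lam))"
      using Delta_quotient[OF len] by blast
    then have "q \<in> J" using key l by (auto simp: quotients_def)
    then show "D (blocks (rev [0..<a + b - l]) (map (\<lambda>i. lam ! i + (l - 1 - i)) [0..<l])) \<in> Q"
      unfolding Key D[OF len] Q_def using q(2) by force
  qed
  then show ?thesis unfolding Q_def D[OF S] by blast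
qed

theorem corollary9p40:
  fixes a b :: nat
  assumes "b \<le> a"
  shows "Iab a b = genideal (E_ring a b)
    (quotients a b {Delta (Key a b l lam) | l lam. l \<le> b \<and> lam \<in> Partitions l (b - l)})"
proof -
  let ?K = "{Delta (Key a b l lam) | l lam. l \<le> b \<and> lam \<in> Partitions l (b - l)}"
  let ?V = "vandermonde 0 a * vandermonde a b"
  interpret cring "E_ring a b" by (rule cring_E_ring)
  define J where "J = genideal (E_ring a b) (quotients a b ?K)"
  have J: "ideal J (E_ring a b)"
    unfolding J_def by (rule genideal_ideal) (rule quotients_subset)
  have K: "quotients a b ?K \<subseteq> J"
    unfolding J_def by (rule genideal_self) (rule quotients_subset)
  have "q \<in> J" if q: "q \<in> quotients a b (antisymmetric a b)" for q
  proof -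
    obtain f where f: "f \<in> antisymmetric a b" "q * ?V = embed a b f"
      using q by (auto simp: quotients_def)
    let ?S = "\<lambda>m. map (\<lambda>j. (Poly_Mapping.lookup m (X j), Poly_Mapping.lookup m (Y j))) [0..<a + b]"
    have "\<exists>q\<in>J. embed a b (Delta (?S m)) = q * ?V" for m
      by (rule embed_Delta_in_key_multiples[OF J K]) simp
    then obtain g where g: "\<And>m. g m \<in> J" "\<And>m. embed a b (Delta (?S m)) = g m * ?V" by metis
    define h where "h = (\<Sum>m\<in>Poly_Mapping.keys f. Const (Poly_Mapping.lookup f m) * g m)"
    have "sum u M \<in> J" if "\<And>m. m \<in> M \<Longrightarrow> u m \<in> J" for u :: "(var \<Rightarrow>\<^sub>0 nat) \<Rightarrow> qpoly" and M
      using that by (induction M rule: infinite_finite_induct) (auto intro: E_ring_ideal[OF J])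
    then have h: "h \<in> J" unfolding h_def by (simp add: E_ring_ideal(3)[OF J Eab_Const] g)
    let ?c = "Const (of_nat (fact (a + b)))"
    have "?c * embed a b f = embed a b (of_nat (fact (a + b)) * f)"
      by (simp only: of_nat_Const embed_def subst_mult subst_Const)
    also have "\<dots> = h * ?V"
      unfolding antisymmetric_expansion[OF f(1)] h_def embed_def subst_sum subst_mult subst_Const
      unfolding embed_def[symmetric] g(2) sum_distrib_right by (simp only: mult.assoc)
    finally have "(?c * q) * ?V = h * ?V" using f(2) by (simp only: mult.assoc)
    then have "?c * q = h" using vandermonde_nonzero by simp
    moreover have "Const (1 / of_nat (fact (a + b))) * (?c * q) = q"
      by (simp add: mult.assoc[symmetric] Const_mult[symmetric]) (simp add: Const_def)
    ultimately have "q = Const (1 / of_nat (fact (a + b))) * h" by simp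
    then show "q \<in> J" using E_ring_ideal(3)[OF J Eab_Const h] by simp
  qed
  then have "Iab a b \<subseteq> J"
    unfolding Iab_def by (intro genideal_minimal[OF J]) blast
  moreover have "J \<subseteq> Iab a b"
    unfolding J_def Iab_def
  proof (rule genideal_minimal[OF genideal_ideal[OF quotients_subset]])
    have "?K \<subseteq> antisymmetric a b"
      by (auto simp: Key_def intro!: Delta_antisymmetric)
    then have "quotients a b ?K \<subseteq> quotients a b (antisymmetric a b)"
      by (auto simp: quotients_def)
    then show "quotients a b ?K \<subseteq> genideal (E_ring a b) (quotients a b (antisymmetric a b))"
      using genideal_self[OF quotients_subset[of a b "antisymmetric a b"]] by blast
  qed
  ultimately show ?thesis unfolding J_def by blast
qed

end
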